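(* Let $A\in\mathbb{R}^{m\times m}$ be symmetric positive semidefinite and let $(w,c)\sim\mathbb{P}$ be random vectors in $\mathbb{R}^k\times\mathbb{R}^m$ with finite second moments such that $\mathbb{E}[ww^\top]$ is invertible. Then, with minimization over $V\in\mathbb{R}^{m\times k}$, $$\operatorname{argmin}_V\mathbb{E}\left[\tfrac12(Vw-c)^\top A(Vw-c)\right]=\operatorname{argmin}_V\mathbb{E}\left[\tfrac12\|Vw-c\|_2^2\right]+\left\{\tilde V\in\mathbb{R}^{m\times k}: A\tilde V=\mathbf{0}\right\}.$$ Consequently, when $X=\{x\in\mathbb{R}^m:p^\top x=b\}$ and $A=Q^{-1}-\frac{1}{p^\top Q^{-1}p}Q^{-1}p(Q^{-1}p)^\top$, with $Q\in\mathbb{R}^{m\times m}$ symmetric positive definite, $p\in\mathbb{R}^m\setminus\{0\}$ and $b\in\mathbb{R}$, every minimizer $V$ of $\mathbb{E}[\ell_{\mathrm{LS}}(Vw,c)]$ is also a minimizer of $\mathbb{E}[L(Vw,c)]$.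
   Context: $\ell_{\mathrm{LS}}(d,c):=\frac12\|d-c\|_2^2$. For $X=\{x\in\mathbb{R}^m:p^\top x=b\}$, let $x^*(d)$ be the unique minimizer of $\frac12x^\top Qx-d^\top x$ over $x\in X$, and $L(d,c):=\frac12x^*(d)^\top Qx^*(d)-c^\top x^*(d)-\min_{x\in X}\{\frac12x^\top Qx-c^\top x\}$. The sum of sets is the Minkowski sum. *)

theory Defs
  imports "HOL-Probability.Probability" "HOL-Library.Set_Algebras"
begin

definition argmin :: "('a \<Rightarrow> real) \<Rightarrow> 'a set"
  where "argmin f = {x. is_arg_min f (\<lambda>_. True) x}"

definition sym_psd :: "real ^ 'n ^ 'n \<Rightarrow> bool"
  where "sym_psd A \<longleftrightarrow> transpose A = A \<and> (\<forall>x. 0 \<le> x \<bullet> (A *v x))"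

definition sym_pd :: "real ^ 'n ^ 'n \<Rightarrow> bool"
  where "sym_pd A \<longleftrightarrow> transpose A = A \<and> (\<forall>x. x \<noteq> 0 \<longrightarrow> 0 < x \<bullet> (A *v x))"

(* The matrix u v^T. *)
definition outer :: "real ^ 'm \<Rightarrow> real ^ 'n \<Rightarrow> real ^ 'n ^ 'm"
  where "outer u v = (\<chi> i j. u $ i * v $ j)"

definition ls_loss :: "real ^ 'm \<Rightarrow> real ^ 'm \<Rightarrow> real"
  where "ls_loss d c = 1 / 2 * (norm (d - c))\<^sup>2"

definition qp_obj :: "real ^ 'm ^ 'm \<Rightarrow> real ^ 'm \<Rightarrow> real ^ 'm \<Rightarrow> real"
  where "qp_obj Q d x = 1 / 2 * (x \<bullet> (Q *v x)) - d \<bullet> x"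

(* The decision x*(d). The description is proper when the minimizer over X is unique, in
   particular for positive definite Q and a nonempty affine X. *)
definition qp_sol :: "real ^ 'm ^ 'm \<Rightarrow> (real ^ 'm) set \<Rightarrow> real ^ 'm \<Rightarrow> real ^ 'm"
  where "qp_sol Q X d = (THE x. is_arg_min (qp_obj Q d) (\<lambda>x. x \<in> X) x)"

(* The loss L(d,c). LEAST renders the minimum value over X; it is unspecified if the minimum
   is not attained. *)
definition decision_loss ::
    "real ^ 'm ^ 'm \<Rightarrow> (real ^ 'm) set \<Rightarrow> real ^ 'm \<Rightarrow> real ^ 'm \<Rightarrow> real"
  where "decision_loss Q X d c =
    qp_obj Q c (qp_sol Q X d) - (LEAST v. v \<in> qp_obj Q c ` X)"

end

theory Submission
  imports Defs
begin

text \<open>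
  Let \<open>W = E[w w\<^sup>T]\<close> and \<open>V\<^sub>0 = E[c w\<^sup>T] W\<inverse>\<close>. By the normal equations the residual
  \<open>V\<^sub>0 w - c\<close> is uncorrelated with \<open>w\<close>, so the \<open>A\<close>-weighted risk at \<open>V\<close> exceeds the one at
  \<open>V\<^sub>0\<close> by \<open>E[(D w) \<bullet> A (D w)] / 2\<close> where \<open>D = V - V\<^sub>0\<close>. This excess vanishes iff \<open>A D w = 0\<close>
  almost surely, i.e. \<open>A D W = 0\<close>, i.e. \<open>A D = 0\<close>. Hence the minimizers are the \<open>V\<close> with
  \<open>A (V - V\<^sub>0) = 0\<close>, and least squares is the case of the identity matrix. For the second claim,
  the quadratic program has the solution \<open>x\<^sup>*(d) = A d + x\<^sup>*(0)\<close>, and \<open>A Q A = A\<close> gives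
  \<open>L(d,c) = (d - c) \<bullet> A (d - c) / 2\<close>.
\<close>

section \<open>Outer products and positive semidefinite matrices\<close>

lemma inner_matrix_symmetric:
  fixes A :: "real ^ 'n ^ 'n"
  assumes "transpose A = A"
  shows "x \<bullet> (A *v y) = y \<bullet> (A *v x)"
  using dot_lmul_matrix[of x A y] assms by (metis inner_commute transpose_matrix_vector)

lemma sym_pd_imp_sym_psd: "sym_pd A \<Longrightarrow> sym_psd A"
  unfolding sym_pd_def sym_psd_def by (metis inner_zero_left less_eq_real_def)

lemma sym_psd_mat_1: "sym_psd (mat 1)"
  by (simp add: sym_psd_def)

text \<open>If the form vanishes at \<open>x\<close> but \<open>A *v x\<close> does not, a short
  step from \<open>x\<close> along \<open>- (A *v x)\<close> makes the form negative: the
  first-order change dominates.\<close>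

lemma sym_psd_inner_eq_0_iff:
  assumes A: "sym_psd A"
  shows "x \<bullet> (A *v x) = 0 \<longleftrightarrow> A *v x = 0"
proof
  assume x: "x \<bullet> (A *v x) = 0"
  show "A *v x = 0"
  proof (rule ccontr)
    define y where "y = A *v x"
    define a where "a = y \<bullet> y"
    define e where "e = y \<bullet> (A *v y)"
    \<comment> \<open>The form at \<open>x + t *\<^sub>R y\<close> is
      \<open>2 * t * a + t\<^sup>2 * e\<close>. The denominator \<open>e + 1\<close> is positive
      even for \<open>e = 0\<close> and gives \<open>t * e = - a - t\<close>, so the value becomes
      \<open>t * (a - t)\<close> with \<open>t < 0 < a\<close>.\<close>
    define t where "t = - a / (e + 1)"
    assume "A *v x \<noteq> 0"
    then have a: "a > 0"
      by (simp add: a_def y_def)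
    have e: "e \<ge> 0"
      using A by (simp add: sym_psd_def e_def)
    have xy: "x \<bullet> (A *v y) = a"
      using A inner_matrix_symmetric[of A x y] by (simp add: sym_psd_def a_def y_def)
    have "(x + t *\<^sub>R y) \<bullet> (A *v (x + t *\<^sub>R y)) = 2 * t * a + t\<^sup>2 * e"
      using x xy
      by (simp add: matrix_vector_right_distrib matrix_vector_mult_scaleR inner_add_left
          inner_add_right a_def e_def power2_eq_square algebra_simps flip: y_def)
    also have "\<dots> = t * (2 * a + t * e)"
      by (simp add: power2_eq_square algebra_simps)
    also have "t * e = - a - t"
      using e by (simp add: t_def field_simps)
    also have "t * (2 * a + (- a - t)) < 0"
      using a e by (intro mult_neg_pos) (simp_all add: t_def add_pos_nonneg divide_neg_pos)
    finally show False
      using A unfolding sym_psd_def by (metis not_less)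
  qed
qed simp

lemma sym_pd_invertible:
  assumes "sym_pd Q"
  shows "invertible Q"
proof -
  have "x = 0" if "Q *v x = 0" for x
    using assms that unfolding sym_pd_def by (metis inner_zero_right less_irrefl)
  then show ?thesis
    using invertible_left_inverse matrix_left_invertible_ker by blast
qed

text \<open>\<open>matrix_inv\<close> is a Hilbert choice, so both identities rest on the existence
  of a two-sided inverse.\<close>

lemma
  fixes Q :: "real ^ 'n ^ 'n"
  assumes "invertible Q"
  shows matrix_inv_right: "Q ** matrix_inv Q = mat 1"
    and matrix_inv_left: "matrix_inv Q ** Q = mat 1"
  using assms someI_ex[of "\<lambda>P. Q ** P = mat 1 \<and> P ** Q = mat 1"]
  unfolding invertible_def matrix_inv_def by blast+

text \<open>Transposing \<open>Q ** matrix_inv Q = mat 1\<close> yields a left inverse of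
  \<open>Q\<close>, which must agree with the right inverse.\<close>

lemma transpose_matrix_inv:
  fixes Q :: "real ^ 'n ^ 'n"
  assumes Q: "invertible Q" "transpose Q = Q"
  shows "transpose (matrix_inv Q) = matrix_inv Q"
proof -
  have "transpose (matrix_inv Q) ** Q = mat 1"
    using Q by (metis matrix_inv_right matrix_transpose_mul transpose_mat)
  then show ?thesis
    using matrix_inv_right[OF Q(1)] by (metis matrix_mul_assoc matrix_mul_lid matrix_mul_rid)
qed

lemma matrix_inv_right_cancel:
  fixes Q :: "real ^ 'n ^ 'n"
  assumes "invertible Q"
  shows "Q *v (matrix_inv Q *v x) = x"
  using assms by (simp add: matrix_vector_mul_assoc matrix_inv_right)

lemma outer_mult_vector: "outer u v *v x = (v \<bullet> x) *\<^sub>R u"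
  by (simp add: vec_eq_iff outer_def matrix_vector_mult_def inner_vec_def sum_distrib_left
      mult_ac)

text \<open>Together with \<open>outer_mult_right\<close> and \<open>trace_outer\<close>, this turns
  expectations of products into linear images of second-moment matrices.\<close>

lemma outer_mult_left: "outer (V *v u) v = V ** outer u v"
  by (simp add: vec_eq_iff outer_def matrix_vector_mult_def matrix_matrix_mult_def
      sum_distrib_left sum_distrib_right mult_ac)

lemma outer_mult_right: "outer u (V *v v) = outer u v ** transpose V"
  by (simp add: vec_eq_iff outer_def matrix_vector_mult_def matrix_matrix_mult_def transpose_def
      sum_distrib_left mult_ac)

lemma trace_outer: "trace (outer u v) = u \<bullet> v"
  by (simp add: outer_def trace_def inner_vec_def)

lemma bounded_bilinear_outer: "bounded_bilinear outer"
  unfolding bilinear_conv_bounded_bilinear[symmetric] bilinear_def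
  by (intro conjI allI linearI) (simp_all add: vec_eq_iff outer_def algebra_simps)

lemma bounded_linear_matrix_mult_left: "bounded_linear ((**) (V :: real ^ 'n ^ 'm))"
  unfolding linear_conv_bounded_linear[symmetric]
  by (intro linearI)
    (simp_all add: vec_eq_iff matrix_matrix_mult_def algebra_simps sum.distrib sum_distrib_left)

lemma bounded_linear_matrix_mult_right:
  "bounded_linear (\<lambda>X :: real ^ 'n ^ 'm. X ** (V :: real ^ 'l ^ 'n))"
  unfolding linear_conv_bounded_linear[symmetric]
  by (intro linearI)
    (simp_all add: vec_eq_iff matrix_matrix_mult_def algebra_simps sum.distrib sum_distrib_left)

lemma bounded_linear_trace: "bounded_linear (trace :: real ^ 'n ^ 'n \<Rightarrow> real)"
  unfolding linear_conv_bounded_linear[symmetric]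
  by (intro linearI) (simp_all add: trace_def sum.distrib sum_distrib_left)

section \<open>Square integrable random vectors\<close>

text \<open>Measurability is a separate conjunct because integrability of the squared norm does not
  imply it.\<close>

definition square_integrable :: "'a measure \<Rightarrow> ('a \<Rightarrow> 'b::euclidean_space) \<Rightarrow> bool"
  where "square_integrable M f \<longleftrightarrow>
    f \<in> borel_measurable M \<and> integrable M (\<lambda>\<omega>. (norm (f \<omega>))\<^sup>2)"

text \<open>The product is dominated by a multiple of
  \<open>(norm x)\<^sup>2 + (norm y)\<^sup>2\<close>. One bound serves inner products, outer
  products and quadratic forms alike.\<close>

lemma square_integrable_bilinear:
  fixes B :: "'b::euclidean_space \<Rightarrow> 'c::euclidean_space \<Rightarrow> 'd::euclidean_space"
  assumes B: "bounded_bilinear B"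
    and f: "square_integrable M f" and g: "square_integrable M g"
  shows "integrable M (\<lambda>\<omega>. B (f \<omega>) (g \<omega>))"
proof -
  obtain K where K: "K > 0" "\<And>x y. norm (B x y) \<le> norm x * norm y * K"
    using bounded_bilinear.pos_bounded[OF B] by blast
  have meas: "(\<lambda>\<omega>. B (f \<omega>) (g \<omega>)) \<in> borel_measurable M"
  proof (rule borel_measurable_continuous_Pair[where H = B])
    show "continuous_on UNIV (\<lambda>x. B (fst x) (snd x))"
      by (intro bounded_bilinear.continuous_on[OF B] continuous_on_fst continuous_on_snd
          continuous_on_id)
  qed (use f g in \<open>auto simp: square_integrable_def\<close>)
  have "norm (B x y) \<le> K * ((norm x)\<^sup>2 + (norm y)\<^sup>2)" for x y
  proof -
    have "norm x * norm y \<le> (norm x)\<^sup>2 + (norm y)\<^sup>2"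
      using sum_squares_bound[of "norm x" "norm y"]
        mult_nonneg_nonneg[OF norm_ge_zero norm_ge_zero, of x y]
      by linarith
    then have "norm x * norm y * K \<le> ((norm x)\<^sup>2 + (norm y)\<^sup>2) * K"
      using K(1) by (intro mult_right_mono) auto
    with K(2)[of x y] show ?thesis
      by (simp add: mult.commute)
  qed
  then have "norm (B x y) \<le> norm (K * ((norm x)\<^sup>2 + (norm y)\<^sup>2))" for x y
    unfolding real_norm_def by (rule order_trans[OF _ abs_ge_self])
  then have bound: "AE \<omega> in M. norm (B (f \<omega>) (g \<omega>))
      \<le> norm (K * ((norm (f \<omega>))\<^sup>2 + (norm (g \<omega>))\<^sup>2))"
    by (rule AE_I2)
  have "integrable M (\<lambda>\<omega>. K * ((norm (f \<omega>))\<^sup>2 + (norm (g \<omega>))\<^sup>2))"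
    using f g by (simp add: square_integrable_def)
  then show ?thesis
    using meas bound by (rule Bochner_Integration.integrable_bound)
qed

lemmas square_integrable_inner = square_integrable_bilinear[OF bounded_bilinear_inner]
lemmas square_integrable_outer = square_integrable_bilinear[OF bounded_bilinear_outer]

lemma square_integrable_matrix_mult:
  fixes V :: "real ^ 'n ^ 'm"
  assumes f: "square_integrable M f"
  shows "square_integrable M (\<lambda>\<omega>. V *v f \<omega>)"
proof -
  have meas: "(\<lambda>\<omega>. V *v f \<omega>) \<in> borel_measurable M"
    using f unfolding square_integrable_def
    by (intro borel_measurable_continuous_on[of "(*v) V"] linear_continuous_on) auto
  \<comment> \<open>The squared norm of \<open>V *v f \<omega>\<close> is the diagonal of this
    form.\<close>
  have "bounded_bilinear (\<lambda>x y. (V *v x) \<bullet> (V *v y))"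
    by (intro bounded_bilinear.comp[OF bounded_bilinear_inner] matrix_vector_mul_bounded_linear)
  from square_integrable_bilinear[OF this f f] meas show ?thesis
    by (simp add: square_integrable_def power2_norm_eq_inner)
qed

lemma square_integrable_diff:
  assumes f: "square_integrable M f" and g: "square_integrable M g"
  shows "square_integrable M (\<lambda>\<omega>. f \<omega> - g \<omega>)"
proof -
  have "integrable M (\<lambda>\<omega>. f \<omega> \<bullet> f \<omega> - 2 * (f \<omega> \<bullet> g \<omega>) + g \<omega> \<bullet> g \<omega>)"
    using f g by (intro Bochner_Integration.integrable_add Bochner_Integration.integrable_diff
        integrable_mult_right square_integrable_inner)
  moreover have "(norm (x - y))\<^sup>2 = x \<bullet> x - 2 * (x \<bullet> y) + y \<bullet> y" for x y :: 'b
    by (simp add: power2_norm_eq_inner inner_diff_left inner_diff_right inner_commute)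
  ultimately show ?thesis
    using f g by (auto simp: square_integrable_def intro: borel_measurable_diff)
qed

section \<open>Weighted least squares\<close>

lemma argmin_iff_excess_eq_0:
  assumes f: "\<And>x. f x = f z + g x" and nonneg: "\<And>x. g x \<ge> 0"
  shows "argmin f = {x. g x = (0::real)}"
proof -
  have "g z = 0"
    using f[of z] by simp
  have "is_arg_min f (\<lambda>_. True) x \<longleftrightarrow> g x = 0" for x
  proof
    assume "is_arg_min f (\<lambda>_. True) x"
    then have "\<not> f z < f x"
      by (auto simp: is_arg_min_def)
    then show "g x = 0"
      using f[of x] nonneg[of x] by linarith
  next
    assume "g x = 0"
    then have "\<not> f y < f x" for y
      using f[of x] f[of y] nonneg[of y] by linarith
    then show "is_arg_min f (\<lambda>_. True) x"
      by (simp add: is_arg_min_def)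
  qed
  then show ?thesis
    by (simp add: argmin_def)
qed

text \<open>The centre \<open>V0\<close> does not depend on \<open>A\<close>, so the minimizers for
  different weights can be compared through it.\<close>

lemma argmin_weighted_least_squares:
  fixes w :: "'a \<Rightarrow> real ^ 'k" and c :: "'a \<Rightarrow> real ^ 'm" and A :: "real ^ 'm ^ 'm"
  assumes w: "square_integrable M w" and c: "square_integrable M c"
    and inv: "invertible (\<integral>\<omega>. outer (w \<omega>) (w \<omega>) \<partial>M)"
    and A: "sym_psd A"
    and V0: "V0 = (\<integral>\<omega>. outer (c \<omega>) (w \<omega>) \<partial>M) ** matrix_inv (\<integral>\<omega>. outer (w \<omega>) (w \<omega>) \<partial>M)"
  shows "argmin (\<lambda>V. \<integral>\<omega>. 1 / 2 * ((V *v w \<omega> - c \<omega>) \<bullet> (A *v (V *v w \<omega> - c \<omega>))) \<partial>M)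
    = {V. A ** (V - V0) = 0}"
proof -
  let ?W = "\<integral>\<omega>. outer (w \<omega>) (w \<omega>) \<partial>M"
  define r where "r \<omega> = V0 *v w \<omega> - c \<omega>" for \<omega>
  define excess where "excess D = (\<integral>\<omega>. 1 / 2 * ((D *v w \<omega>) \<bullet> (A *v (D *v w \<omega>))) \<partial>M)"
    for D :: "real ^ 'k ^ 'm"
  have psd: "x \<bullet> (A *v x) \<ge> 0" for x
    using A by (simp add: sym_psd_def)
  have r: "square_integrable M r"
    unfolding r_def by (intro square_integrable_diff square_integrable_matrix_mult w c)
  have moment_mult: "(\<integral>\<omega>. outer (V *v w \<omega>) (w \<omega>) \<partial>M) = V ** ?W" for V :: "real ^ 'k ^ 'm"
    unfolding outer_mult_left
    by (intro integral_bounded_linear bounded_linear_matrix_mult_left square_integrable_outer w)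
  have "(\<integral>\<omega>. outer (r \<omega>) (w \<omega>) \<partial>M)
      = (\<integral>\<omega>. outer (V0 *v w \<omega>) (w \<omega>) - outer (c \<omega>) (w \<omega>) \<partial>M)"
    by (simp add: r_def bounded_bilinear.diff_left[OF bounded_bilinear_outer])
  also have "\<dots> = V0 ** ?W - (\<integral>\<omega>. outer (c \<omega>) (w \<omega>) \<partial>M)"
    by (simp add: moment_mult square_integrable_outer square_integrable_matrix_mult w c)
  also have "\<dots> = 0"
    by (simp add: V0 matrix_mul_assoc[symmetric] matrix_inv_left[OF inv])
  finally have normal_eq: "(\<integral>\<omega>. outer (r \<omega>) (w \<omega>) \<partial>M) = 0" .
  have cross: "(\<integral>\<omega>. (A *v r \<omega>) \<bullet> (D *v w \<omega>) \<partial>M) = 0" for D :: "real ^ 'k ^ 'm"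
  proof -
    \<comment> \<open>At \<open>X = outer (r \<omega>) (w \<omega>)\<close> this functional is the
      cross term, so its mean is the functional at the mean of \<open>X\<close>, which is zero by
      the normal equations.\<close>
    have "bounded_linear (\<lambda>X. trace (A ** (X ** transpose D)))"
      by (intro bounded_linear_compose[OF bounded_linear_trace]
          bounded_linear_compose[OF bounded_linear_matrix_mult_left]
          bounded_linear_matrix_mult_right)
    from integral_bounded_linear[OF this square_integrable_outer[OF r w]]
    have "(\<integral>\<omega>. trace (A ** (outer (r \<omega>) (w \<omega>) ** transpose D)) \<partial>M)
        = trace (A ** ((\<integral>\<omega>. outer (r \<omega>) (w \<omega>) \<partial>M) ** transpose D))" .
    then show ?thesis
      by (simp add: normal_eq trace_def flip: trace_outer outer_mult_left outer_mult_right)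
  qed
  have decomp: "(\<integral>\<omega>. 1 / 2 * ((V *v w \<omega> - c \<omega>) \<bullet> (A *v (V *v w \<omega> - c \<omega>))) \<partial>M)
      = (\<integral>\<omega>. 1 / 2 * ((V0 *v w \<omega> - c \<omega>) \<bullet> (A *v (V0 *v w \<omega> - c \<omega>))) \<partial>M) + excess (V - V0)" for V
  proof -
    define D where "D = V - V0"
    have residual: "V *v w \<omega> - c \<omega> = r \<omega> + D *v w \<omega>" for \<omega>
      by (simp add: r_def D_def matrix_vector_mult_diff_rdistrib)
    have "(V *v w \<omega> - c \<omega>) \<bullet> (A *v (V *v w \<omega> - c \<omega>))
        = r \<omega> \<bullet> (A *v r \<omega>) + 2 * ((A *v r \<omega>) \<bullet> (D *v w \<omega>))
          + (D *v w \<omega>) \<bullet> (A *v (D *v w \<omega>))" for \<omega>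
      unfolding residual
      using A inner_matrix_symmetric[of A "r \<omega>" "D *v w \<omega>"]
      by (simp add: sym_psd_def matrix_vector_right_distrib inner_add_left inner_add_right
          inner_commute)
    then have "(\<integral>\<omega>. 1 / 2 * ((V *v w \<omega> - c \<omega>) \<bullet> (A *v (V *v w \<omega> - c \<omega>))) \<partial>M)
        = (\<integral>\<omega>. 1 / 2 * (r \<omega> \<bullet> (A *v r \<omega>)) + (A *v r \<omega>) \<bullet> (D *v w \<omega>)
          + 1 / 2 * ((D *v w \<omega>) \<bullet> (A *v (D *v w \<omega>))) \<partial>M)"
      by (simp add: algebra_simps)
    also have "\<dots> = (\<integral>\<omega>. 1 / 2 * (r \<omega> \<bullet> (A *v r \<omega>)) \<partial>M) + (\<integral>\<omega>. (A *v r \<omega>) \<bullet> (D *v w \<omega>) \<partial>M)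
        + excess D"
      unfolding excess_def
      by (simp add: square_integrable_inner square_integrable_matrix_mult r w)
    finally show ?thesis
      unfolding cross by (simp only: r_def D_def add_0_right)
  qed
  have excess_nonneg: "excess D \<ge> 0" for D
    unfolding excess_def by (intro integral_nonneg_AE AE_I2) (simp add: psd)
  have excess_0: "excess D = 0 \<longleftrightarrow> A ** D = 0" for D
  proof
    assume "excess D = 0"
    then have "AE \<omega> in M. 1 / 2 * ((D *v w \<omega>) \<bullet> (A *v (D *v w \<omega>))) = 0"
      unfolding excess_def
      by (subst (asm) integral_nonneg_eq_0_iff_AE)
        (auto intro!: integrable_divide square_integrable_inner square_integrable_matrix_mult w
          simp: psd)
    \<comment> \<open>Multiplying \<open>A D w = 0\<close> by the transpose of \<open>w\<close>
      makes the moment matrix appear on integration; its invertibility then removes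
      \<open>w\<close>.\<close>
    then have "AE \<omega> in M. outer ((A ** D) *v w \<omega>) (w \<omega>) = 0"
      by eventually_elim
        (simp add: sym_psd_inner_eq_0_iff[OF A]
          bounded_bilinear.zero_left[OF bounded_bilinear_outer] flip: matrix_vector_mul_assoc)
    then have "(A ** D) ** ?W = 0"
      unfolding moment_mult[symmetric] by (rule integral_eq_zero_AE)
    then have "(A ** D) ** (?W ** matrix_inv ?W) = 0"
      by (simp add: matrix_mul_assoc)
    then show "A ** D = 0"
      by (simp add: matrix_inv_right[OF inv])
  qed (simp add: excess_def matrix_vector_mul_assoc)
  show ?thesis
    unfolding excess_0[symmetric]
    by (rule argmin_iff_excess_eq_0[where z = V0]) (fact decomp excess_nonneg)+
qed

section \<open>The decision loss of an equality constrained quadratic program\<close>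

text \<open>The second-order Taylor expansion of a quadratic is exact; \<open>Q *v x - d\<close> is
  the gradient at \<open>x\<close>.\<close>

lemma qp_obj_expand:
  assumes "transpose Q = Q"
  shows "qp_obj Q d y = qp_obj Q d x + (Q *v x - d) \<bullet> (y - x) + 1 / 2 * ((y - x) \<bullet> (Q *v (y - x)))"
  using inner_matrix_symmetric[OF assms, of x y]
  by (simp add: qp_obj_def matrix_vector_mult_diff_distrib inner_diff_left inner_diff_right
      inner_commute algebra_simps)

context
  fixes Q A :: "real ^ 'm ^ 'm" and p :: "real ^ 'm"
  assumes Q: "sym_pd Q" and p: "p \<noteq> 0"
    and A: "A = matrix_inv Q
      - (1 / (p \<bullet> (matrix_inv Q *v p))) *\<^sub>R outer (matrix_inv Q *v p) (matrix_inv Q *v p)"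
begin

private abbreviation (input) "q \<equiv> matrix_inv Q *v p"

private lemma inv_Q: "invertible Q"
  using Q by (rule sym_pd_invertible)

private lemma sym_Q: "transpose Q = Q"
  using Q by (simp add: sym_pd_def)

text \<open>This denominator of \<open>A\<close> equals the form of \<open>Q\<close> at
  \<open>q\<close>.\<close>

private lemma p_inner_q_pos: "p \<bullet> q > 0"
proof -
  have "q \<noteq> 0"
    using p matrix_inv_right_cancel[OF inv_Q, of p] by auto
  then have "q \<bullet> (Q *v q) > 0"
    using Q unfolding sym_pd_def by blast
  then show ?thesis
    by (simp add: matrix_inv_right_cancel[OF inv_Q] inner_commute)
qed

private lemma sym_inv_Q: "transpose (matrix_inv Q) = matrix_inv Q"
  using inv_Q sym_Q by (rule transpose_matrix_inv)

private lemma A_mult: "A *v u = matrix_inv Q *v u - ((q \<bullet> u) / (p \<bullet> q)) *\<^sub>R q"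
  by (simp add: A matrix_vector_mult_diff_rdistrib scaleR_matrix_vector_assoc[symmetric]
      outer_mult_vector)

text \<open>Modulo multiples of \<open>p\<close>, \<open>A\<close> is a right inverse of
  \<open>Q\<close>; such multiples vanish against directions orthogonal to \<open>p\<close>.\<close>

private lemma Q_A_mult: "Q *v (A *v u) = u - ((q \<bullet> u) / (p \<bullet> q)) *\<^sub>R p"
  by (simp add: A_mult matrix_vector_mult_diff_distrib matrix_vector_mult_scaleR
      matrix_inv_right_cancel[OF inv_Q])

private lemma p_inner_A: "p \<bullet> (A *v u) = 0"
  using p_inner_q_pos inner_matrix_symmetric[OF sym_inv_Q, of p u]
  by (simp add: A_mult inner_diff_right inner_commute)

private lemma A_Q_A: "(A *v u) \<bullet> (Q *v (A *v u)) = u \<bullet> (A *v u)"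
  using p_inner_A[of u] by (simp add: Q_A_mult inner_diff_right inner_commute)

text \<open>By \<open>A_Q_A\<close>, the form of \<open>A\<close> at \<open>u\<close> is the form of
  \<open>Q\<close> at \<open>A *v u\<close>.\<close>

lemma sym_psd_reduced_inverse: "sym_psd A"
proof -
  have "transpose A = A"
    using sym_inv_Q
    by (simp add: A vec_eq_iff transpose_def outer_def mult.commute)
  moreover have "u \<bullet> (A *v u) \<ge> 0" for u
    using sym_pd_imp_sym_psd[OF Q] unfolding A_Q_A[symmetric] sym_psd_def by blast
  ultimately show ?thesis
    by (simp add: sym_psd_def)
qed

text \<open>The solution of the Lagrange conditions: \<open>A *v d\<close> stays orthogonal to
  \<open>p\<close>, and the multiple of \<open>q\<close> meets the constraint.\<close>

private definition "sol b d = A *v d + (b / (p \<bullet> q)) *\<^sub>R q"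

private lemma sol_feasible: "p \<bullet> sol b d = b"
  using p_inner_q_pos by (simp add: sol_def inner_add_right p_inner_A)

private lemma qp_obj_sol:
  assumes "p \<bullet> y = b"
  shows "qp_obj Q d y = qp_obj Q d (sol b d) + 1 / 2 * ((y - sol b d) \<bullet> (Q *v (y - sol b d)))"
proof -
  \<comment> \<open>The coefficient is the Lagrange multiplier: the gradient is normal to the
    hyperplane, so the linear term vanishes on feasible differences.\<close>
  have "Q *v sol b d - d = ((b - q \<bullet> d) / (p \<bullet> q)) *\<^sub>R p"
    by (simp add: sol_def matrix_vector_right_distrib Q_A_mult matrix_vector_mult_scaleR
        matrix_inv_right_cancel[OF inv_Q] diff_divide_distrib scaleR_diff_left)
  then have "(Q *v sol b d - d) \<bullet> (y - sol b d) = 0"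
    using assms by (simp add: inner_diff_right sol_feasible)
  then show ?thesis
    using qp_obj_expand[OF sym_Q, of d y "sol b d"] by simp
qed

private lemma qp_obj_sol_le:
  assumes "p \<bullet> y = b"
  shows "qp_obj Q d (sol b d) \<le> qp_obj Q d y"
  using qp_obj_sol[OF assms, of d] sym_pd_imp_sym_psd[OF Q] by (simp add: sym_psd_def)

private lemma qp_sol_eq: "qp_sol Q {x. p \<bullet> x = b} d = sol b d"
  unfolding qp_sol_def
proof (rule the_equality)
  show "is_arg_min (qp_obj Q d) (\<lambda>x. x \<in> {x. p \<bullet> x = b}) (sol b d)"
    by (auto simp: is_arg_min_def sol_feasible not_less qp_obj_sol_le)
next
  fix y
  assume "is_arg_min (qp_obj Q d) (\<lambda>x. x \<in> {x. p \<bullet> x = b}) y"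
  then have y: "p \<bullet> y = b" and "qp_obj Q d y \<le> qp_obj Q d (sol b d)"
    using sol_feasible by (auto simp: is_arg_min_def not_less)
  \<comment> \<open>Uniqueness: a second minimizer leaves no positive gap, and strict definiteness
    then forces equality.\<close>
  then have "(y - sol b d) \<bullet> (Q *v (y - sol b d)) \<le> 0"
    using qp_obj_sol[OF y, of d] by linarith
  then show "y = sol b d"
    using Q unfolding sym_pd_def by (metis not_less right_minus_eq)
qed

text \<open>The loss is the gap, for cost \<open>c\<close>, between the feasible point
  \<open>sol b d\<close> and the optimum \<open>sol b c\<close>. The terms in \<open>b\<close>
  cancel in their difference, and \<open>A_Q_A\<close> absorbs \<open>Q\<close>.\<close>

lemma decision_loss_affine:
  "decision_loss Q {x. p \<bullet> x = b} d c = 1 / 2 * ((d - c) \<bullet> (A *v (d - c)))"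
proof -
  have "(LEAST v. v \<in> qp_obj Q c ` {x. p \<bullet> x = b}) = qp_obj Q c (sol b c)"
    by (rule Least_equality) (auto simp: sol_feasible qp_obj_sol_le)
  moreover have "sol b d - sol b c = A *v (d - c)"
    by (simp add: sol_def matrix_vector_mult_diff_distrib)
  ultimately show ?thesis
    using qp_obj_sol[OF sol_feasible, of c b d]
    by (simp add: decision_loss_def qp_sol_eq A_Q_A)
qed

end

theorem proposition4:
  fixes M :: "'a measure"
    and w :: "'a \<Rightarrow> real ^ 'k"
    and c :: "'a \<Rightarrow> real ^ 'm"
  assumes "prob_space M"
    and "w \<in> borel_measurable M"
    and "c \<in> borel_measurable M"
    and "integrable M (\<lambda>\<omega>. (norm (w \<omega>))\<^sup>2)"
    and "integrable M (\<lambda>\<omega>. (norm (c \<omega>))\<^sup>2)"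
    and "invertible (\<integral>\<omega>. outer (w \<omega>) (w \<omega>) \<partial>M)"
  shows "(\<forall>A :: real ^ 'm ^ 'm. sym_psd A \<longrightarrow>
            argmin (\<lambda>V :: real ^ 'k ^ 'm.
              \<integral>\<omega>. 1 / 2 * ((V *v w \<omega> - c \<omega>) \<bullet> (A *v (V *v w \<omega> - c \<omega>))) \<partial>M)
            = argmin (\<lambda>V. \<integral>\<omega>. 1 / 2 * (norm (V *v w \<omega> - c \<omega>))\<^sup>2 \<partial>M)
              + {V'. A ** V' = 0})
       \<and> (\<forall>(A :: real ^ 'm ^ 'm) (Q :: real ^ 'm ^ 'm) (p :: real ^ 'm) (b :: real) X.
            sym_pd Q \<longrightarrow> p \<noteq> 0 \<longrightarrow>
            A = matrix_inv Q
                - (1 / (p \<bullet> (matrix_inv Q *v p))) *\<^sub>R outer (matrix_inv Q *v p) (matrix_inv Q *v p) \<longrightarrow>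
            X = {x. p \<bullet> x = b} \<longrightarrow>
            argmin (\<lambda>V :: real ^ 'k ^ 'm. \<integral>\<omega>. ls_loss (V *v w \<omega>) (c \<omega>) \<partial>M)
            \<subseteq> argmin (\<lambda>V. \<integral>\<omega>. decision_loss Q X (V *v w \<omega>) (c \<omega>) \<partial>M))"
proof -
  define V0 where
    "V0 = (\<integral>\<omega>. outer (c \<omega>) (w \<omega>) \<partial>M) ** matrix_inv (\<integral>\<omega>. outer (w \<omega>) (w \<omega>) \<partial>M)"
  have weighted: "argmin (\<lambda>V. \<integral>\<omega>. 1 / 2 * ((V *v w \<omega> - c \<omega>) \<bullet> (A *v (V *v w \<omega> - c \<omega>))) \<partial>M)
      = {V. A ** (V - V0) = 0}" if "sym_psd A" for A
    using assms that
    by (intro argmin_weighted_least_squares V0_def) (simp_all add: square_integrable_def)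
  \<comment> \<open>With the identity as weight, the condition on \<open>V - V0\<close> leaves only
    \<open>V0\<close>.\<close>
  have least_squares: "argmin (\<lambda>V. \<integral>\<omega>. 1 / 2 * (norm (V *v w \<omega> - c \<omega>))\<^sup>2 \<partial>M) = {V0}"
    using weighted[OF sym_psd_mat_1] by (simp add: power2_norm_eq_inner)
  show ?thesis
  proof (intro conjI allI impI)
    fix A :: "real ^ 'm ^ 'm"
    assume "sym_psd A"
    moreover have "{V. A ** (V - V0) = 0} = {V0} + {V'. A ** V' = 0}"
      by (force simp: set_plus_def intro: exI[of _ "_ - V0"])
    ultimately show "argmin (\<lambda>V :: real ^ 'k ^ 'm.
          \<integral>\<omega>. 1 / 2 * ((V *v w \<omega> - c \<omega>) \<bullet> (A *v (V *v w \<omega> - c \<omega>))) \<partial>M)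
        = argmin (\<lambda>V. \<integral>\<omega>. 1 / 2 * (norm (V *v w \<omega> - c \<omega>))\<^sup>2 \<partial>M) + {V'. A ** V' = 0}"
      by (simp only: weighted least_squares)
  next
    fix A Q :: "real ^ 'm ^ 'm" and p :: "real ^ 'm" and b :: real and X
    assume Q: "sym_pd Q" and p: "p \<noteq> 0"
      and A: "A = matrix_inv Q
        - (1 / (p \<bullet> (matrix_inv Q *v p))) *\<^sub>R outer (matrix_inv Q *v p) (matrix_inv Q *v p)"
      and X: "X = {x. p \<bullet> x = b}"
    show "argmin (\<lambda>V :: real ^ 'k ^ 'm. \<integral>\<omega>. ls_loss (V *v w \<omega>) (c \<omega>) \<partial>M)
        \<subseteq> argmin (\<lambda>V. \<integral>\<omega>. decision_loss Q X (V *v w \<omega>) (c \<omega>) \<partial>M)"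
      \<comment> \<open>Both losses are now weighted least squares, so what remains is that
        \<open>V0\<close> satisfies \<open>A ** (V0 - V0) = 0\<close>.\<close>
      unfolding ls_loss_def X decision_loss_affine[OF Q p A] least_squares
        weighted[OF sym_psd_reduced_inverse[OF Q p A]]
      by simp
  qed
qed

end
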